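(* Let $p$ be a prime and let $G$ be a finite non-abelian group such that $\frac{G}{Z(G)}$ is non-abelian and $\left|\frac{G}{Z(G)}\right| = p^3$. Then $\mathcal{CCC}(G)$ satisfies the Hansen-Vukičević conjecture, that is, $$\frac{M_2(\mathcal{CCC}(G))}{|e(\mathcal{CCC}(G))|} \geq \frac{M_1(\mathcal{CCC}(G))}{|v(\mathcal{CCC}(G))|}.$$
   Context: $Z(G)$ denotes the center of $G$. For a finite group $G$ and $x \in G$, $x^G$ denotes the conjugacy class of $x$ in $G$. The commuting conjugacy class graph $\mathcal{CCC}(G)$ is the simple undirected graph whose vertices are the conjugacy classes of non-central elements of $G$, where two distinct vertices $x^G$ and $y^G$ are adjacent if and only if there exist $x' \in x^G$ and $y' \in y^G$ with $x'y' = y'x'$. For a finite simple graph $\Gamma$ with vertex set $v(\Gamma)$ and edge set $e(\Gamma)$, the first and second Zagreb indices are $M_1(\Gamma) = \sum_{v \in v(\Gamma)} \deg(v)^2$ and $M_2(\Gamma) = \sum_{uv \in e(\Gamma)} \deg(u)\deg(v)$. *)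

theory Defs
  imports Complex_Main "HOL-Algebra.Algebra"
begin

section \<open>Center and conjugacy classes\<close>

definition center :: "('a, 'b) monoid_scheme \<Rightarrow> 'a set" where
  "center G = {z \<in> carrier G. \<forall>g \<in> carrier G. g \<otimes>\<^bsub>G\<^esub> z = z \<otimes>\<^bsub>G\<^esub> g}"

definition conj_class :: "('a, 'b) monoid_scheme \<Rightarrow> 'a \<Rightarrow> 'a set" where
  "conj_class G x = (\<lambda>g. g \<otimes>\<^bsub>G\<^esub> x \<otimes>\<^bsub>G\<^esub> inv\<^bsub>G\<^esub> g) ` carrier G"

text \<open>\<open>G Mod N\<close> is a group only for normal \<open>N\<close>.\<close>

lemma (in group) center_normal: "center G \<lhd> G"
proof -
  have "subgroup (center G) G"
  proof (rule subgroupI)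
    show "center G \<subseteq> carrier G"
      by (auto simp: center_def)
    have "\<one> \<in> center G"
      by (simp add: center_def)
    then show "center G \<noteq> {}"
      by blast
  next
    fix z assume z: "z \<in> center G"
    then have zc: "z \<in> carrier G"
      and comm: "\<And>g. g \<in> carrier G \<Longrightarrow> g \<otimes> z = z \<otimes> g"
      by (auto simp: center_def)
    have "g \<otimes> inv z = inv z \<otimes> g" if g: "g \<in> carrier G" for g
      using comm[of "inv g"] zc g by (metis inv_closed inv_inv inv_mult_group)
    then show "inv z \<in> center G"
      using zc by (simp add: center_def)
  next
    fix y z assume "y \<in> center G" "z \<in> center G"
    then have yz: "y \<in> carrier G" "z \<in> carrier G"
      and comm: "\<And>g. g \<in> carrier G \<Longrightarrow> g \<otimes> y = y \<otimes> g"
                "\<And>g. g \<in> carrier G \<Longrightarrow> g \<otimes> z = z \<otimes> g"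
      by (auto simp: center_def)
    have "g \<otimes> (y \<otimes> z) = y \<otimes> z \<otimes> g" if g: "g \<in> carrier G" for g
      using comm yz g by (metis m_assoc)
    then show "y \<otimes> z \<in> center G"
      using yz by (simp add: center_def)
  qed
  moreover have "g \<otimes> z \<otimes> inv g \<in> center G"
    if "g \<in> carrier G" "z \<in> center G" for g z
  proof -
    have "z \<in> carrier G" "g \<otimes> z = z \<otimes> g"
      using that by (auto simp: center_def)
    then have "g \<otimes> z \<otimes> inv g = z"
      using that(1) by (simp add: m_assoc)
    then show ?thesis
      using that(2) by simp
  qed
  ultimately show ?thesis
    by (simp add: normal_inv_iff)
qed


section \<open>Simple graphs and Zagreb indices\<close>

text \<open>
  A simple undirected graph is a pair of a vertex set and an edge set; an edge \<open>uv\<close> is the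
  two-element set \<open>{u, v}\<close>, so every undirected edge is counted once.
\<close>

type_synonym 'v ugraph = "'v set \<times> 'v set set"

abbreviation verts :: "'v ugraph \<Rightarrow> 'v set" where "verts \<equiv> fst"

abbreviation edges :: "'v ugraph \<Rightarrow> 'v set set" where "edges \<equiv> snd"

definition simple_graph :: "'v ugraph \<Rightarrow> bool" where
  "simple_graph \<Gamma> \<longleftrightarrow> finite (verts \<Gamma>) \<and> (\<forall>e \<in> edges \<Gamma>. e \<subseteq> verts \<Gamma> \<and> card e = 2)"

definition vdeg :: "'v ugraph \<Rightarrow> 'v \<Rightarrow> nat" where
  "vdeg \<Gamma> v = card {e \<in> edges \<Gamma>. v \<in> e}"

definition zagreb1 :: "'v ugraph \<Rightarrow> nat" where
  "zagreb1 \<Gamma> = (\<Sum>v \<in> verts \<Gamma>. (vdeg \<Gamma> v)\<^sup>2)"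

text \<open>For an edge \<open>e = {u, v}\<close> the product over \<open>e\<close> is \<open>vdeg u * vdeg v\<close>.\<close>

definition zagreb2 :: "'v ugraph \<Rightarrow> nat" where
  "zagreb2 \<Gamma> = (\<Sum>e \<in> edges \<Gamma>. \<Prod>v \<in> e. vdeg \<Gamma> v)"


section \<open>The commuting conjugacy class graph\<close>

definition ccc_graph :: "('a, 'b) monoid_scheme \<Rightarrow> 'a set ugraph" where
  "ccc_graph G =
    (let V = conj_class G ` (carrier G - center G)
     in (V, {{C, D} | C D. C \<in> V \<and> D \<in> V \<and> C \<noteq> D \<and>
                           (\<exists>x \<in> C. \<exists>y \<in> D. x \<otimes>\<^bsub>G\<^esub> y = y \<otimes>\<^bsub>G\<^esub> x)}))"

lemma simple_graph_ccc_graph: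
  assumes "finite (carrier G)"
  shows "simple_graph (ccc_graph G)"
  using assms by (fastforce simp: simple_graph_def ccc_graph_def Let_def card_2_iff)

end

theory Submission
  imports Defs
begin

text \<open>
  Two elements commuting with a common non-central element commute with each other: otherwise
  intersections of their centralizers would form a chain of five distinct subgroups between the
  center and \<open>G\<close>, which is too long for an index of \<open>p\<^sup>3\<close>. Hence the commuting conjugacy class
  graph is a disjoint union of cliques, so that adjacent vertices have the same degree. Writing
  \<open>d v\<close> for the degree of \<open>v\<close>, one gets \<open>2 |e| = \<Sum> d v\<close> and \<open>2 M\<^sub>2 = \<Sum> (d v)\<^sup>3\<close>, and
  the inequality becomes Chebyshev's sum inequality for \<open>d\<close> and \<open>d\<^sup>2\<close>.
\<close>

section \<open>Graphs whose edges join vertices of equal degree\<close>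

text \<open>Summing the products of differences over all ordered pairs gives twice the right side
  minus the left side. The pairwise sign condition spares sorting the index set.\<close>

lemma Chebyshev_sum_same_order:
  fixes f g :: "'i \<Rightarrow> 'r::linordered_idom"
  assumes "\<And>u v. u \<in> A \<Longrightarrow> v \<in> A \<Longrightarrow> 0 \<le> (f u - f v) * (g u - g v)"
  shows "sum f A * sum g A \<le> of_nat (card A) * (\<Sum>v\<in>A. f v * g v)"
proof -
  let ?S = "\<Sum>v\<in>A. f v * g v"
  have "0 \<le> (\<Sum>u\<in>A. \<Sum>v\<in>A. (f u - f v) * (g u - g v))"
    using assms by (intro sum_nonneg) auto
  also have "\<dots> = (\<Sum>u\<in>A. \<Sum>v\<in>A. f u * g u) - (\<Sum>u\<in>A. \<Sum>v\<in>A. f u * g v)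
      - (\<Sum>u\<in>A. \<Sum>v\<in>A. f v * g u) + (\<Sum>u\<in>A. \<Sum>v\<in>A. f v * g v)"
    by (simp only: sum_subtractf[symmetric] sum.distrib[symmetric])
       (simp add: algebra_simps)
  also have "(\<Sum>u\<in>A. \<Sum>v\<in>A. f v * g u) = (\<Sum>u\<in>A. \<Sum>v\<in>A. f u * g v)"
    by (rule sum.swap)
  also have "(\<Sum>u\<in>A. \<Sum>v\<in>A. f u * g v) = sum f A * sum g A"
    by (rule sum_product[symmetric])
  finally have "0 \<le> 2 * (of_nat (card A) * ?S - sum f A * sum g A)"
    by (simp add: sum_distrib_left algebra_simps)
  then show ?thesis
    by (simp add: zero_le_mult_iff)
qed

lemma simple_graph_finite_edges:
  assumes "simple_graph \<Gamma>"
  shows "finite (edges \<Gamma>)"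
proof (rule finite_subset)
  show "edges \<Gamma> \<subseteq> Pow (verts \<Gamma>)" and "finite (Pow (verts \<Gamma>))"
    using assms by (auto simp: simple_graph_def)
qed

text \<open>Double counting of incident pairs of a vertex and an edge, each weighted by
  \<open>f\<close> at the vertex. Weight 1 gives the handshake lemma, weight
  \<open>(vdeg \<Gamma> v)\<^sup>2\<close> the sum of cubes.\<close>

lemma sum_mult_vdeg:
  fixes f :: "'v \<Rightarrow> nat"
  assumes \<Gamma>: "simple_graph \<Gamma>"
  shows "(\<Sum>v\<in>verts \<Gamma>. f v * vdeg \<Gamma> v) = (\<Sum>e\<in>edges \<Gamma>. sum f e)"
proof -
  have "(\<Sum>v\<in>verts \<Gamma>. f v * vdeg \<Gamma> v) = (\<Sum>v\<in>verts \<Gamma>. \<Sum>e | e \<in> edges \<Gamma> \<and> v \<in> e. f v)"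
    by (simp add: vdeg_def mult.commute)
  also have "\<dots> = (\<Sum>e\<in>edges \<Gamma>. \<Sum>v | v \<in> verts \<Gamma> \<and> v \<in> e. f v)"
    using \<Gamma> simple_graph_finite_edges[OF \<Gamma>]
    by (intro sum.swap_restrict) (auto simp: simple_graph_def)
  also have "\<dots> = (\<Sum>e\<in>edges \<Gamma>. sum f e)"
    using \<Gamma> by (intro sum.cong refl) (auto simp: simple_graph_def)
  finally show ?thesis .
qed

lemma Hansen_Vukicevic_equal_degrees:
  assumes \<Gamma>: "simple_graph \<Gamma>"
    and eq: "\<And>u v. {u, v} \<in> edges \<Gamma> \<Longrightarrow> vdeg \<Gamma> u = vdeg \<Gamma> v"
  shows "real (zagreb2 \<Gamma>) / real (card (edges \<Gamma>)) \<ge> real (zagreb1 \<Gamma>) / real (card (verts \<Gamma>))"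
proof -
  let ?d = "vdeg \<Gamma>" and ?V = "verts \<Gamma>" and ?E = "edges \<Gamma>"
  have sum_d: "(\<Sum>v\<in>?V. ?d v) = 2 * card ?E"
    using sum_mult_vdeg[OF \<Gamma>, of "\<lambda>_. 1"] \<Gamma> by (simp add: simple_graph_def)
  \<comment> \<open>Both ends have the same degree d, so the two sides equal 2 d^2.\<close>
  have edge: "(\<Sum>v\<in>e. (?d v)\<^sup>2) = 2 * (\<Prod>v\<in>e. ?d v)" if "e \<in> ?E" for e
  proof -
    from \<Gamma> that obtain u v where "e = {u, v}" "u \<noteq> v"
      by (auto simp: simple_graph_def card_2_iff)
    moreover have "?d u = ?d v"
      using eq that \<open>e = {u, v}\<close> by blast
    ultimately show ?thesis
      by (simp add: power2_eq_square)
  qed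
  have sum_d3: "(\<Sum>v\<in>?V. (?d v)\<^sup>2 * ?d v) = 2 * zagreb2 \<Gamma>"
    using sum_mult_vdeg[OF \<Gamma>, of "\<lambda>v. (?d v)\<^sup>2"]
    by (simp add: zagreb2_def edge sum_distrib_left)
  have "(\<Sum>v\<in>?V. (real (?d v))\<^sup>2) * (\<Sum>v\<in>?V. real (?d v))
      \<le> real (card ?V) * (\<Sum>v\<in>?V. (real (?d v))\<^sup>2 * real (?d v))"
  proof (rule Chebyshev_sum_same_order)
    fix u v
    \<comment> \<open>This is the factorization (a^2 - b^2)(a - b) = (a - b)^2 (a + b).\<close>
    have "0 \<le> (real (?d u) - real (?d v))\<^sup>2 * (real (?d u) + real (?d v))"
      by simp
    then show "0 \<le> ((real (?d u))\<^sup>2 - (real (?d v))\<^sup>2) * (real (?d u) - real (?d v))"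
      by (simp add: power2_eq_square algebra_simps)
  qed
  moreover have "(\<Sum>v\<in>?V. (real (?d v))\<^sup>2) = real (zagreb1 \<Gamma>)"
    by (simp add: zagreb1_def)
  moreover have "(\<Sum>v\<in>?V. real (?d v)) = 2 * real (card ?E)"
    using arg_cong[OF sum_d, of real] by simp
  moreover have "(\<Sum>v\<in>?V. (real (?d v))\<^sup>2 * real (?d v)) = 2 * real (zagreb2 \<Gamma>)"
    using arg_cong[OF sum_d3, of real] by simp
  ultimately have main:
    "real (zagreb1 \<Gamma>) * real (card ?E) \<le> real (zagreb2 \<Gamma>) * real (card ?V)"
    by (simp add: algebra_simps)
  show ?thesis
  proof (cases "?E = {}")
    case True
    \<comment> \<open>Without edges the left side is a division by zero, hence 0, and all degrees
      vanish.\<close>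
    then have "zagreb1 \<Gamma> = 0"
      by (simp add: zagreb1_def vdeg_def)
    then show ?thesis
      by simp
  next
    case False
    then have "0 < card ?E"
      using simple_graph_finite_edges[OF \<Gamma>] by (simp add: card_gt_0_iff)
    with main show ?thesis
      by (cases "card ?V = 0") (simp_all add: divide_simps mult_ac)
  qed
qed

text \<open>Transitivity gives adjacent vertices the same closed neighbourhood. The degree is one
  less than its size, since no vertex is its own neighbour.\<close>

lemma equal_degrees_if_transitive:
  assumes \<Gamma>: "simple_graph \<Gamma>"
    and trans: "\<And>u v w. {u, v} \<in> edges \<Gamma> \<Longrightarrow> {v, w} \<in> edges \<Gamma> \<Longrightarrow> u \<noteq> w \<Longrightarrow> {u, w} \<in> edges \<Gamma>"
    and uv: "{u, v} \<in> edges \<Gamma>"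
  shows "vdeg \<Gamma> u = vdeg \<Gamma> v"
proof -
  define N where "N x = {y. {x, y} \<in> edges \<Gamma>}" for x
  have loop: "{x} \<notin> edges \<Gamma>" for x
    using \<Gamma> by (force simp: simple_graph_def)
  \<comment> \<open>Sending a neighbour \<open>y\<close> to the edge \<open>{x, y}\<close> is a
    bijection onto the edges at \<open>x\<close>.\<close>
  have vdeg: "vdeg \<Gamma> x = card (N x)" for x
  proof -
    have "\<exists>y. e = {x, y}" if "e \<in> edges \<Gamma>" "x \<in> e" for e
      using \<Gamma> that by (auto simp: simple_graph_def card_2_iff)
    then have "{e \<in> edges \<Gamma>. x \<in> e} = (\<lambda>y. {x, y}) ` N x"
      by (auto simp: N_def)
    moreover have "inj_on (\<lambda>y. {x, y}) (N x)"
      by (auto simp: inj_on_def doubleton_eq_iff)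
    ultimately show ?thesis
      by (simp add: vdeg_def card_image)
  qed
  have fin: "finite (N x)" for x
  proof (rule finite_subset)
    show "N x \<subseteq> verts \<Gamma>" and "finite (verts \<Gamma>)"
      using \<Gamma> by (auto simp: N_def simple_graph_def)
  qed
  have notin: "x \<notin> N x" for x
    using loop by (simp add: N_def)
  have vu: "{v, u} \<in> edges \<Gamma>"
    using uv by (simp add: insert_commute)
  have "insert u (N u) = insert v (N v)"
    using trans[OF uv] trans[OF vu] uv vu by (auto simp: N_def)
  then have "Suc (card (N u)) = Suc (card (N v))"
    using fin notin by (metis card_insert_disjoint)
  then show ?thesis
    by (simp add: vdeg)
qed

section \<open>Groups with center of index \<open>p\<^sup>3\<close>\<close>

context group
begin

section \<open>Centralizers and subgroup chains above the center\<close>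

definition elt_centralizer :: "'a \<Rightarrow> 'a set" where
  "elt_centralizer x = {g \<in> carrier G. g \<otimes> x = x \<otimes> g}"

lemma subgroup_elt_centralizer:
  assumes x: "x \<in> carrier G"
  shows "subgroup (elt_centralizer x) G"
proof (rule subgroupI)
  show "elt_centralizer x \<subseteq> carrier G"
    by (auto simp: elt_centralizer_def)
  have "\<one> \<in> elt_centralizer x"
    using x by (simp add: elt_centralizer_def)
  then show "elt_centralizer x \<noteq> {}"
    by blast
next
  fix g assume "g \<in> elt_centralizer x"
  then have g: "g \<in> carrier G" and gx: "g \<otimes> x = x \<otimes> g"
    by (auto simp: elt_centralizer_def)
  have "inv g \<otimes> x = inv g \<otimes> (x \<otimes> g) \<otimes> inv g"
    using g x by (simp add: m_assoc)
  also have "\<dots> = inv g \<otimes> (g \<otimes> x) \<otimes> inv g"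
    by (simp add: gx)
  also have "\<dots> = x \<otimes> inv g"
    using g x by (simp add: m_assoc[symmetric])
  finally show "inv g \<in> elt_centralizer x"
    using g by (simp add: elt_centralizer_def)
next
  fix g h assume "g \<in> elt_centralizer x" "h \<in> elt_centralizer x"
  then have gh: "g \<in> carrier G" "h \<in> carrier G" and gx: "g \<otimes> x = x \<otimes> g" and hx: "h \<otimes> x = x \<otimes> h"
    by (auto simp: elt_centralizer_def)
  have "g \<otimes> h \<otimes> x = (g \<otimes> x) \<otimes> h"
    using gh x by (simp add: m_assoc hx)
  then show "g \<otimes> h \<in> elt_centralizer x"
    using gh x by (simp add: elt_centralizer_def gx m_assoc)
qed

text \<open>Lagrange's theorem inside \<open>K\<close>, with \<open>k\<close> the index of
  \<open>H\<close>. Knowing \<open>k \<noteq> 1\<close> suffices later, where \<open>k\<close>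
  divides a power of a prime.\<close>

lemma psubset_subgroup_card:
  assumes "finite (carrier G)" "subgroup H G" "subgroup K G" "H \<subset> K"
  obtains k where "card K = card H * k" "k \<noteq> 1"
proof -
  interpret K: group "G\<lparr>carrier := K\<rparr>"
    by (rule subgroup.subgroup_is_group[OF assms(3)]) (rule is_group)
  have "subgroup H (G\<lparr>carrier := K\<rparr>)"
    using assms by (intro subgroup_incl) auto
  then have "card (rcosets\<^bsub>G\<lparr>carrier := K\<rparr>\<^esub> H) * card H = card K"
    using K.lagrange[of H] by (simp add: order_def)
  then obtain k where k: "card K = card H * k"
    by (metis mult.commute)
  have "finite K"
    using subgroup.subset[OF assms(3)] assms(1) by (rule finite_subset)
  then have "card H < card K"
    using assms(4) by (rule psubset_card_mono)
  then have "k \<noteq> 1"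
    using k by auto
  with k show ?thesis
    by (rule that)
qed

lemma noncentral_commute_trans:
  assumes p: "Factorial_Ring.prime p" and fin: "finite (carrier G)"
    and index: "order (G Mod center G) = p ^ 3"
    and x: "x \<in> carrier G" and y: "y \<in> carrier G - center G" and w: "w \<in> carrier G"
    and xy: "x \<otimes> y = y \<otimes> x" and yw: "y \<otimes> w = w \<otimes> y"
  shows "x \<otimes> w = w \<otimes> x"
proof (rule ccontr)
  assume xw: "x \<otimes> w \<noteq> w \<otimes> x"
  let ?Z = "center G" and ?A = "elt_centralizer y \<inter> elt_centralizer x \<inter> elt_centralizer w"
    and ?B = "elt_centralizer y \<inter> elt_centralizer x" and ?C = "elt_centralizer y"
  have Z: "subgroup ?Z G"
    using center_normal by (rule normal_imp_subgroup)
  have C: "subgroup ?C G" and B: "subgroup ?B G" and A: "subgroup ?A G"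
    using x y w by (simp_all add: subgroup_elt_centralizer subgroups_Inter_pair)
  \<comment> \<open>First link of the chain \<open>?Z\<close>, \<open>?A\<close>, \<open>?B\<close>,
    \<open>?C\<close>, \<open>carrier G\<close>: the non-central \<open>y\<close> commutes with
    \<open>x\<close>, \<open>w\<close> and itself. The next two links are strict because of
    \<open>x\<close> and \<open>w\<close>, which do not commute; the last because \<open>y\<close>
    is not central.\<close>
  have "?Z \<subset> ?A"
    using x y w xy yw by (auto simp: elt_centralizer_def center_def)
  then obtain a where a: "card ?A = card ?Z * a" "a \<noteq> 1"
    using psubset_subgroup_card[OF fin Z A] by blast
  have "x \<in> ?B - ?A"
    using x xy xw by (auto simp: elt_centralizer_def)
  then have "?A \<subset> ?B"
    by blast
  then obtain b where b: "card ?B = card ?A * b" "b \<noteq> 1"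
    using psubset_subgroup_card[OF fin A B] by blast
  have "w \<in> ?C - ?B"
    using w yw xw by (auto simp: elt_centralizer_def)
  then have "?B \<subset> ?C"
    by blast
  then obtain c where c: "card ?C = card ?B * c" "c \<noteq> 1"
    using psubset_subgroup_card[OF fin B C] by blast
  have "?C \<subset> carrier G"
    using y by (auto simp: elt_centralizer_def center_def)
  then obtain d where d: "card (carrier G) = card ?C * d" "d \<noteq> 1"
    using psubset_subgroup_card[OF fin C subgroup_self] by blast
  have "card (carrier G) = card ?Z * p ^ 3"
    using lagrange[OF Z] index by (simp add: order_def FactGroup_def mult.commute)
  moreover have "card ?Z > 0"
    using Z fin by (rule subgroup.finite_imp_card_positive)
  ultimately have abcd: "a * b * c * d = p ^ 3"
    using a b c d by (simp add: mult.assoc)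
  \<comment> \<open>A divisor of \<open>p ^ 3\<close> is a power of \<open>p\<close>, with positive
    exponent unless it is 1. So each of the four indices contributes a factor \<open>p\<close>, one
    too many.\<close>
  have dvd: "p dvd k" if "k dvd p ^ 3" "k \<noteq> 1" for k
    using that divides_primepow_nat[OF p] by (metis dvd_power gr0I power_0)
  have "a dvd p ^ 3" "b dvd p ^ 3" "c dvd p ^ 3" "d dvd p ^ 3"
    unfolding abcd[symmetric] by simp_all
  then have "p dvd a" "p dvd b" "p dvd c" "p dvd d"
    using a(2) b(2) c(2) d(2) by (simp_all add: dvd)
  then have "p * p * p * p dvd p ^ 3"
    unfolding abcd[symmetric] by (intro mult_dvd_mono)
  then have "p ^ 4 dvd p ^ 3"
    by (simp add: numeral_eq_Suc mult.assoc)
  then show False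
    using power_dvd_imp_le[of p 4 3] prime_gt_1_nat[OF p] by simp
qed

section \<open>Conjugation and adjacency of classes\<close>

lemma inv_mult_cancel_left:
  assumes "g \<in> carrier G" "x \<in> carrier G"
  shows "inv g \<otimes> (g \<otimes> x) = x"
  using assms by (simp add: m_assoc[symmetric])

lemma conj_mult:
  assumes "g \<in> carrier G" "x \<in> carrier G" "y \<in> carrier G"
  shows "g \<otimes> x \<otimes> inv g \<otimes> (g \<otimes> y \<otimes> inv g) = g \<otimes> (x \<otimes> y) \<otimes> inv g"
  using assms by (simp add: m_assoc inv_mult_cancel_left)

text \<open>Normality of the center, applied to \<open>g\<close> and to its inverse. It makes every
  member of a vertex of the graph non-central, whichever representative is chosen.\<close>

lemma conj_in_center_iff:
  assumes "g \<in> carrier G" "x \<in> carrier G"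
  shows "g \<otimes> x \<otimes> inv g \<in> center G \<longleftrightarrow> x \<in> center G"
proof
  assume "x \<in> center G"
  then show "g \<otimes> x \<otimes> inv g \<in> center G"
    using normal.inv_op_closed2[OF center_normal assms(1)] by blast
next
  assume "g \<otimes> x \<otimes> inv g \<in> center G"
  then have "inv g \<otimes> (g \<otimes> x \<otimes> inv g) \<otimes> g \<in> center G"
    using normal.inv_op_closed1[OF center_normal assms(1)] by blast
  then show "x \<in> center G"
    using assms by (simp add: m_assoc inv_mult_cancel_left)
qed

lemma conj_class_conj:
  assumes "a \<in> carrier G" "x \<in> conj_class G a" "g \<in> carrier G"
  shows "g \<otimes> x \<otimes> inv g \<in> conj_class G a"
proof -
  from assms(2) obtain h where h: "h \<in> carrier G" "x = h \<otimes> a \<otimes> inv h"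
    by (auto simp: conj_class_def)
  then have "g \<otimes> x \<otimes> inv g = (g \<otimes> h) \<otimes> a \<otimes> inv (g \<otimes> h)"
    using assms(1,3) by (simp add: m_assoc inv_mult_group)
  then show ?thesis
    using h assms(3) unfolding conj_class_def by blast
qed

lemma conj_class_conjugate:
  assumes "a \<in> carrier G" "y \<in> conj_class G a" "z \<in> conj_class G a"
  obtains g where "g \<in> carrier G" "z = g \<otimes> y \<otimes> inv g"
proof -
  from assms(2,3) obtain h k where hk: "h \<in> carrier G" "y = h \<otimes> a \<otimes> inv h"
      "k \<in> carrier G" "z = k \<otimes> a \<otimes> inv k"
    by (auto simp: conj_class_def)
  \<comment> \<open>The conjugator first carries \<open>y\<close> back to \<open>a\<close> by
    \<open>inv h\<close>, then \<open>a\<close> to \<open>z\<close> by \<open>k\<close>.\<close>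
  have "z = (k \<otimes> inv h) \<otimes> y \<otimes> inv (k \<otimes> inv h)"
    using hk assms(1) by (simp add: m_assoc inv_mult_group inv_mult_cancel_left)
  moreover have "k \<otimes> inv h \<in> carrier G"
    using hk by simp
  ultimately show ?thesis
    using that by blast
qed

text \<open>The two edges may use different representatives \<open>y\<close> and \<open>z\<close> of
  \<open>D\<close>. Conjugating the first commuting pair by an element that takes \<open>y\<close>
  to \<open>z\<close> makes both pairs share \<open>z\<close>, and
  \<open>noncentral_commute_trans\<close> applies.\<close>

lemma ccc_graph_transitive:
  assumes p: "Factorial_Ring.prime p" and fin: "finite (carrier G)"
    and index: "order (G Mod center G) = p ^ 3"
    and CD: "{C, D} \<in> edges (ccc_graph G)" and DE: "{D, E} \<in> edges (ccc_graph G)"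
    and "C \<noteq> E"
  shows "{C, E} \<in> edges (ccc_graph G)"
proof -
  let ?V = "conj_class G ` (carrier G - center G)"
  \<comment> \<open>An unordered pair matches its ends in either order; the symmetry of commuting
    absorbs this.\<close>
  have edge: "{A, B} \<in> edges (ccc_graph G) \<longleftrightarrow> A \<in> ?V \<and> B \<in> ?V \<and> A \<noteq> B \<and>
      (\<exists>x\<in>A. \<exists>y\<in>B. x \<otimes> y = y \<otimes> x)" for A B
    by (auto simp: ccc_graph_def Let_def doubleton_eq_iff) metis+
  have elt: "x \<in> carrier G - center G" if "A \<in> ?V" "x \<in> A" for A x
    using that by (auto simp: conj_class_def conj_in_center_iff)
  from CD obtain x y where xy: "x \<in> C" "y \<in> D" "x \<otimes> y = y \<otimes> x"
    and CV: "C \<in> ?V" and DV: "D \<in> ?V"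
    unfolding edge by blast
  from DE obtain z w where zw: "z \<in> D" "w \<in> E" "z \<otimes> w = w \<otimes> z" and EV: "E \<in> ?V"
    unfolding edge by blast
  from DV obtain a where "a \<in> carrier G" "D = conj_class G a"
    by blast
  with xy zw obtain g where g: "g \<in> carrier G" "z = g \<otimes> y \<otimes> inv g"
    using conj_class_conjugate by metis
  let ?x = "g \<otimes> x \<otimes> inv g"
  have x: "x \<in> carrier G" and y: "y \<in> carrier G"
    using elt CV DV xy by blast+
  \<comment> \<open>This is \<open>x \<otimes> y = y \<otimes> x\<close> conjugated by
    \<open>g\<close>.\<close>
  have "?x \<otimes> z = z \<otimes> ?x"
    using conj_mult[OF g(1) x y] conj_mult[OF g(1) y x] xy g by simp
  then have "?x \<otimes> w = w \<otimes> ?x"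
    using noncentral_commute_trans[OF p fin index, of ?x z w] elt[OF DV zw(1)] elt[OF EV zw(2)] zw(3) g x
    by simp
  moreover have "?x \<in> C"
    using CV xy(1) g(1) conj_class_conj by blast
  ultimately show ?thesis
    using CV EV zw(2) \<open>C \<noteq> E\<close> unfolding edge by blast
qed

end

theorem theorem2p16:
  fixes G :: "('a, 'b) monoid_scheme" and p :: nat
  assumes "Factorial_Ring.prime p"
    and "group G"
    and "finite (carrier G)"
    and "\<not> comm_group G"
    and "\<not> comm_group (G Mod center G)"
    and "Coset.order (G Mod center G) = p ^ 3"
  shows "real (zagreb2 (ccc_graph G)) / real (card (edges (ccc_graph G)))
       \<ge> real (zagreb1 (ccc_graph G)) / real (card (verts (ccc_graph G)))"
proof (rule Hansen_Vukicevic_equal_degrees)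
  show simple: "simple_graph (ccc_graph G)"
    using assms(3) by (rule simple_graph_ccc_graph)
  show "vdeg (ccc_graph G) C = vdeg (ccc_graph G) D" if "{C, D} \<in> edges (ccc_graph G)" for C D
    using simple group.ccc_graph_transitive[OF assms(2,1,3,6)] that
    by (rule equal_degrees_if_transitive)
qed

end
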